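(* For a finite set $S$ of points in $\mathbb{R}^d$, $V_m^d(S)$ is the set of vertices of an $\ell$-polytope where $\ell\le\binom{m+d}{m}-1$. If $V_{m/2}^d(S)$ is in general linear position and $m\ge 2$ is even, then $V_m^d(S)$ is a $\left(\binom{m/2+d}{m/2}-1\right)$-neighborly $\ell$-polytope.
   Context: For positive integers $d$ and $m$, the degree $m$ Veronese map of $\mathbb{R}^d$ is the map $V_m^d:\mathbb{R}^d\to\mathbb{R}^{\binom{d+m}{m}-1}$ which maps $(x_1,\dots,x_d)$ to the vector (in some order) of all non-constant monomials of degree at most $m$ in the $d$ variables $x_1,\dots,x_d$. A set of at least $p+1$ points in $\mathbb{R}^p$ is in general linear position if no $p+1$ (and thus, fewer) points are affinely dependent. An $\ell$-polytope is a polytope of dimension $\ell$. A polytope is $k$-neighborly if any set of $k$ or fewer vertices forms a face; a set of points is said to be $k$-neighborly if it is the vertex set of a $k$-neighborly polytope.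
   Formalization: The first sentence is stated for m ≥ 2 only, odd or even; for m = 1 it is false, since V_1 is the identity up to the order of coordinates and three collinear points are not the vertex set of a polytope. *)

theory Defs
  imports "HOL-Analysis.Analysis"
begin

definition nonconstant_exponents :: "nat \<Rightarrow> ('d::finite \<Rightarrow> nat) set" where
  "nonconstant_exponents m = {a. 1 \<le> (\<Sum>j\<in>UNIV. a j) \<and> (\<Sum>j\<in>UNIV. a j) \<le> m}"

text \<open>
  The bijection \<open>e\<close> is the unspecified order in which the monomials are listed as coordinates.
  Its existence forces \<open>CARD('n)\<close> to be the number of non-constant monomials of degree at most
  \<open>m\<close> in \<open>CARD('d)\<close> variables, i.e. \<open>(CARD('d) + m choose m) - 1\<close>.
\<close>

definition veronese_map :: "nat \<Rightarrow> (real ^ 'd::finite \<Rightarrow> real ^ 'n::finite) \<Rightarrow> bool" where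
  "veronese_map m V \<longleftrightarrow>
     (\<exists>e :: 'n \<Rightarrow> 'd \<Rightarrow> nat. bij_betw e UNIV (nonconstant_exponents m) \<and>
        (\<forall>x. V x = (\<chi> i. \<Prod>j\<in>UNIV. x $ j ^ e i j)))"

text \<open>The first conjunct is the requirement of at least \<open>DIM('a) + 1\<close> points.\<close>

definition general_linear_position :: "'a::euclidean_space set \<Rightarrow> bool" where
  "general_linear_position A \<longleftrightarrow>
     (finite A \<longrightarrow> DIM('a) + 1 \<le> card A) \<and>
     (\<forall>T. T \<subseteq> A \<and> card T = DIM('a) + 1 \<longrightarrow> \<not> affine_dependent T)"

text \<open>The dimension is an \<open>int\<close> because the empty polytope has dimension \<open>- 1\<close>.\<close>

definition polytope_of_dim :: "int \<Rightarrow> 'a::euclidean_space set \<Rightarrow> bool" where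
  "polytope_of_dim l P \<longleftrightarrow> polytope P \<and> aff_dim P = l"

definition vertices :: "'a::real_vector set \<Rightarrow> 'a set" where
  "vertices P = {v. v extreme_point_of P}"

definition neighborly :: "nat \<Rightarrow> 'a::euclidean_space set \<Rightarrow> bool" where
  "neighborly k P \<longleftrightarrow> polytope P \<and>
     (\<forall>T. T \<subseteq> vertices P \<and> finite T \<and> card T \<le> k \<longrightarrow> (convex hull T) face_of P)"

end

theory Submission
  imports Defs
begin

text \<open>
  Every polynomial of degree at most \<open>m\<close> is an affine functional composed with \<open>V\<^sub>m\<close>. A polynomial
  of degree at most \<open>m\<close> that vanishes on \<open>T \<subseteq> S\<close> and is positive on \<open>S - T\<close> therefore exhibits
  the convex hull of \<open>V\<^sub>m(T)\<close> as a face of the convex hull of \<open>V\<^sub>m(S)\<close>. For \<open>T = {x}\<close> take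
  the squared distance to \<open>x\<close>. For \<open>T\<close> of size less than \<open>(m/2 + d choose m/2)\<close>, general linear
  position gives for each \<open>x \<in> S - T\<close> a polynomial of degree at most \<open>m/2\<close> vanishing on \<open>T\<close>
  but not at \<open>x\<close>; take the sum of their squares.
\<close>

section \<open>The number of monomials\<close>

text \<open>Splitting off the value \<open>k\<close> at a new point leaves a function on the old
  domain with sum at most \<open>m - k\<close>, hence \<open>m\<close> is arbitrary in the
  induction. Demanding zero outside \<open>D\<close> makes each function on \<open>D\<close>
  correspond to exactly one total function.\<close>

lemma card_bounded_sum_functions:
  fixes D :: "'a set"
  assumes "finite D"
  shows "finite {f :: 'a \<Rightarrow> nat. (\<forall>x. x \<notin> D \<longrightarrow> f x = 0) \<and> sum f D \<le> m} \<and>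
         card {f :: 'a \<Rightarrow> nat. (\<forall>x. x \<notin> D \<longrightarrow> f x = 0) \<and> sum f D \<le> m} = (m + card D) choose m"
  using assms
proof (induction D arbitrary: m rule: finite_induct)
  case empty
  have "{f :: 'a \<Rightarrow> nat. \<forall>x. f x = 0} = {\<lambda>_. 0}" by auto
  then show ?case by simp
next
  case (insert y D)
  define F where
    "F D m = {f :: 'a \<Rightarrow> nat. (\<forall>x. x \<notin> D \<longrightarrow> f x = 0) \<and> sum f D \<le> m}" for D m
  have IH: "finite (F D k)" "card (F D k) = (k + card D) choose k" for k
    using insert.IH[of k] by (auto simp: F_def)
  define B where "B = (SIGMA k:{..m}. F D (m - k))"
  have sum_upd: "(\<Sum>x\<in>D. if x = y then k else f x) = sum f D" for f :: "'a \<Rightarrow> nat" and k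
    using insert.hyps(2) by (intro sum.cong) auto
  have bij: "bij_betw (\<lambda>f. (f y, f(y := 0))) (F (insert y D) m) B"
  proof (rule bij_betw_byWitness[where f' = "\<lambda>(k, f). f(y := k)"])
    show "\<forall>f\<in>F (insert y D) m. (\<lambda>(k, f). f(y := k)) (f y, f(y := 0)) = f"
      by auto
    show "\<forall>p\<in>B. (\<lambda>f. (f y, f(y := 0))) ((\<lambda>(k, f). f(y := k)) p) = p"
      using insert.hyps(2) by (auto simp: B_def F_def fun_eq_iff)
    show "(\<lambda>f. (f y, f(y := 0))) ` F (insert y D) m \<subseteq> B"
      using insert.hyps by (auto simp: B_def F_def sum_upd)
    show "(\<lambda>(k, f). f(y := k)) ` B \<subseteq> F (insert y D) m"
      using insert.hyps by (auto simp: B_def F_def sum_upd)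
  qed
  have "finite B"
    using IH(1) by (auto simp: B_def)
  moreover have "card B = (m + card (insert y D)) choose m"
  proof -
    have "card B = (\<Sum>k\<le>m. (m - k + card D) choose (m - k))"
      using IH by (simp add: B_def)
    \<comment> \<open>Reversing the order of summation gives the form of the hockey-stick
      identity.\<close>
    also have "\<dots> = (\<Sum>k\<le>m. (card D + k) choose k)"
      by (rule sum.reindex_bij_witness[where i = "\<lambda>k. m - k" and j = "\<lambda>k. m - k"])
        (auto simp: add.commute)
    also have "\<dots> = Suc (card D + m) choose m"
      by (rule sum_choose_lower)
    finally show ?thesis
      using insert.hyps by (simp add: add.commute)
  qed
  ultimately show ?case
    using bij_betw_finite[OF bij] bij_betw_same_card[OF bij] unfolding F_def by simp
qed

lemma card_nonconstant_exponents:
  "card (nonconstant_exponents m :: ('d::finite \<Rightarrow> nat) set) = ((m + CARD('d)) choose m) - 1"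
proof -
  let ?A = "{f :: 'd \<Rightarrow> nat. sum f UNIV \<le> m}"
  have "finite ?A" "card ?A = (m + CARD('d)) choose m"
    using card_bounded_sum_functions[of "UNIV :: 'd set" m] by auto
  moreover have "nonconstant_exponents m = ?A - {\<lambda>_. 0}"
    by (auto simp: nonconstant_exponents_def Suc_le_eq fun_eq_iff intro: Nat.gr0I)
  ultimately show ?thesis by simp
qed

text \<open>Turns binomial coefficients into dimensions of coordinate spaces, for the large map as
  well as for the one of half the degree.\<close>

lemma veronese_map_CARD:
  fixes V :: "real ^ 'd::finite \<Rightarrow> real ^ 'n::finite"
  assumes "veronese_map m V"
  shows "CARD('n) = ((m + CARD('d)) choose m) - 1"
  using assms card_nonconstant_exponents[where 'd = 'd, of m]
  unfolding veronese_map_def by (metis bij_betw_same_card)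

section \<open>Polynomials of bounded degree\<close>

text \<open>The linear span of the monomials of degree at most \<open>m\<close>. Generating it
  inductively lets linear arguments reduce to monomials by rule induction.\<close>

inductive polyfun :: "nat \<Rightarrow> (real ^ 'd::finite \<Rightarrow> real) \<Rightarrow> bool" for m where
  monomial: "(\<Sum>j\<in>UNIV. a j) \<le> m \<Longrightarrow> polyfun m (\<lambda>x. \<Prod>j\<in>UNIV. x $ j ^ a j)"
| add: "polyfun m f \<Longrightarrow> polyfun m g \<Longrightarrow> polyfun m (\<lambda>x. f x + g x)"
| scale: "polyfun m f \<Longrightarrow> polyfun m (\<lambda>x. c * f x)"

lemma polyfun_const: "polyfun m (\<lambda>_. c)"
  using polyfun.scale[OF polyfun.monomial[of "\<lambda>_. 0" m], of c] by simp

lemma polyfun_sum: "(\<And>i. i \<in> I \<Longrightarrow> polyfun m (f i)) \<Longrightarrow> polyfun m (\<lambda>x. \<Sum>i\<in>I. f i x)"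
  by (induction I rule: infinite_finite_induct) (auto intro: polyfun_const polyfun.add)

lemma polyfun_mono: "polyfun m f \<Longrightarrow> m \<le> n \<Longrightarrow> polyfun n f"
  by (induction rule: polyfun.induct) (auto intro: polyfun.intros)

text \<open>Bilinearity reduces the claim to two monomials, by one induction nested in another;
  there the exponents add.\<close>

lemma polyfun_mult:
  assumes f: "polyfun m f" and g: "polyfun n g"
  shows "polyfun (m + n) (\<lambda>x. f x * g x)"
  using f
proof (induction rule: polyfun.induct)
  case (monomial a)
  show ?case
    using g
  proof (induction rule: polyfun.induct)
    case (monomial b)
    show ?case
      using polyfun.monomial[of "\<lambda>j. a j + b j" "m + n"] \<open>sum a UNIV \<le> m\<close> monomial
      by (simp add: sum.distrib power_add prod.distrib)
  next
    case (add f g)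
    then show ?case
      using polyfun.add[OF add.IH] by (simp add: distrib_left)
  next
    case (scale f c)
    then show ?case
      using polyfun.scale[OF scale.IH, of c] by (simp add: mult.left_commute)
  qed
next
  case (add f1 f2)
  then show ?case
    using polyfun.add[OF add.IH] by (simp add: distrib_right)
next
  case (scale f c)
  then show ?case
    using polyfun.scale[OF scale.IH, of c] by (simp add: mult.assoc)
qed

lemma polyfun_component: "polyfun 1 (\<lambda>x :: real ^ 'd::finite. x $ j)"
proof -
  have "(\<Prod>i\<in>UNIV. x $ i ^ (if i = j then 1 else 0)) = (\<Prod>i\<in>UNIV. if i = j then x $ i else 1)"
    for x :: "real ^ 'd"
    by (intro prod.cong) auto
  also have "(\<Prod>i\<in>UNIV. if i = j then x $ i else 1) = x $ j" for x :: "real ^ 'd"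
    by simp
  finally show ?thesis
    using polyfun.monomial[where 'd = 'd, of "\<lambda>i. if i = j then 1 else 0" 1] by simp
qed

lemma polyfun_sq_dist: "polyfun 2 (\<lambda>y :: real ^ 'd::finite. \<Sum>j\<in>UNIV. (y $ j - x $ j)\<^sup>2)"
proof (rule polyfun_sum)
  fix j
  have "polyfun 1 (\<lambda>y :: real ^ 'd. y $ j - x $ j)"
    using polyfun.add[OF polyfun_component polyfun_const[of 1 "- (x $ j)"]] by simp
  from polyfun_mult[OF this this] show "polyfun 2 (\<lambda>y. (y $ j - x $ j)\<^sup>2)"
    by (simp add: power2_eq_square numeral_2_eq_2)
qed

text \<open>Used to pull a hyperplane in the target space back to a polynomial;
  \<open>veronese_polyfun_affine\<close> is the converse.\<close>

lemma polyfun_veronese_affine: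
  assumes "veronese_map m V"
  shows "polyfun m (\<lambda>x. a \<bullet> V x + c)"
proof -
  obtain e where e: "bij_betw e UNIV (nonconstant_exponents m)"
    and V: "\<And>x. V x = (\<chi> i. \<Prod>j\<in>UNIV. x $ j ^ e i j)"
    using assms unfolding veronese_map_def by blast
  have "e i \<in> nonconstant_exponents m" for i
    using e by (auto simp: bij_betw_def)
  then have "polyfun m (\<lambda>x. a $ i * (\<Prod>j\<in>UNIV. x $ j ^ e i j))" for i
    by (intro polyfun.scale polyfun.monomial) (simp add: nonconstant_exponents_def)
  then show ?thesis
    unfolding inner_vec_def V by (auto intro!: polyfun.add polyfun_sum polyfun_const)
qed

lemma veronese_polyfun_affine:
  assumes V: "veronese_map m V" and "polyfun m f"
  obtains a c where "\<And>x. f x = a \<bullet> V x + c"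
proof -
  obtain e where e: "bij_betw e UNIV (nonconstant_exponents m)"
    and V: "\<And>x. V x = (\<chi> i. \<Prod>j\<in>UNIV. x $ j ^ e i j)"
    using V unfolding veronese_map_def by blast
  have "\<exists>a c. \<forall>x. f x = a \<bullet> V x + c"
    using \<open>polyfun m f\<close>
  proof (induction rule: polyfun.induct)
    case (monomial b)
    show ?case
    \<comment> \<open>The constant monomial is no coordinate of \<open>V\<close> and goes into the
      constant term; any other monomial is a coordinate, picked out by an axis vector.\<close>
    proof (cases "sum b UNIV = 0")
      case True
      then have "(\<Prod>j\<in>UNIV. x $ j ^ b j) = 0 \<bullet> V x + 1" for x
        by simp
      then show ?thesis by blast
    next
      case False
      with monomial have "b \<in> nonconstant_exponents m"
        by (simp add: nonconstant_exponents_def Suc_le_eq del: sum_eq_0_iff)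
      then have "b \<in> range e"
        using e by (simp add: bij_betw_def)
      then obtain i where "b = e i"
        by (rule rangeE)
      then have "(\<Prod>j\<in>UNIV. x $ j ^ b j) = axis i 1 \<bullet> V x + 0" for x
        by (simp add: V inner_axis')
      then show ?thesis by blast
    qed
  next
    case (add f g)
    then obtain a c a' c' where "\<And>x. f x = a \<bullet> V x + c" "\<And>x. g x = a' \<bullet> V x + c'"
      by blast
    then have "f x + g x = (a + a') \<bullet> V x + (c + c')" for x
      by (simp add: inner_add_left)
    then show ?case by blast
  next
    case (scale f k)
    then obtain a c where "\<And>x. f x = a \<bullet> V x + c"
      by blast
    then have "k * f x = (k *\<^sub>R a) \<bullet> V x + k * c" for x
      by (simp add: distrib_left)
    then show ?case by blast
  qed
  then show ?thesis using that by blast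
qed

text \<open>Each coordinate of \<open>x\<close> is a polynomial of degree 1, hence determined by
  \<open>V x\<close>.\<close>

lemma inj_veronese_map:
  assumes V: "veronese_map m V" and "1 \<le> m"
  shows "inj V"
proof (rule injI)
  fix x y assume "V x = V y"
  have "x $ j = y $ j" for j
  proof -
    obtain a c where "\<And>z. z $ j = a \<bullet> V z + c"
      using veronese_polyfun_affine[OF V polyfun_mono[OF polyfun_component \<open>1 \<le> m\<close>]] by metis
    then show ?thesis using \<open>V x = V y\<close> by metis
  qed
  then show "x = y" by (simp add: vec_eq_iff)
qed

section \<open>Faces\<close>

lemma veronese_face:
  assumes V: "veronese_map m V" and "finite S" "T \<subseteq> S" and f: "polyfun m f"
    and zero: "\<And>x. x \<in> T \<Longrightarrow> f x = 0" and pos: "\<And>x. x \<in> S - T \<Longrightarrow> f x > 0"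
  shows "(convex hull (V ` T)) face_of (convex hull (V ` S))"
proof (rule face_of_convex_hulls)
  obtain a c where f: "\<And>x. f x = a \<bullet> V x + c"
    using veronese_polyfun_affine[OF V f] by blast
  have "affine hull (V ` T) \<subseteq> {v. a \<bullet> v = - c}"
    using zero by (intro hull_minimal affine_hyperplane) (force simp: f)
  moreover have "convex hull (V ` S - V ` T) \<subseteq> {v. a \<bullet> v > - c}"
    using pos by (intro hull_minimal convex_halfspace_gt) (force simp: f)
  ultimately show "affine hull (V ` T) \<inter> convex hull (V ` S - V ` T) = {}"
    by fastforce
qed (use \<open>finite S\<close> \<open>T \<subseteq> S\<close> in auto)

lemma vertices_convex_hull_veronese:
  assumes V: "veronese_map m V" and "2 \<le> m" "finite S"
  shows "vertices (convex hull (V ` S)) = V ` S"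
proof
  show "vertices (convex hull (V ` S)) \<subseteq> V ` S"
    using extreme_point_of_convex_hull by (auto simp: vertices_def)
  show "V ` S \<subseteq> vertices (convex hull (V ` S))"
  proof (rule image_subsetI)
    fix x assume "x \<in> S"
    have "(\<Sum>j\<in>UNIV. (y $ j - x $ j)\<^sup>2) > 0" if "y \<noteq> x" for y
    proof -
      obtain j where "y $ j \<noteq> x $ j"
        using \<open>y \<noteq> x\<close> by (auto simp: vec_eq_iff)
      then show ?thesis by (intro sum_pos2[of _ j]) auto
    qed
    then have "(convex hull (V ` {x})) face_of (convex hull (V ` S))"
      using \<open>x \<in> S\<close> \<open>finite S\<close>
      by (intro veronese_face[OF V _ _ polyfun_mono[OF polyfun_sq_dist[of x] \<open>2 \<le> m\<close>]]) auto
    then show "V x \<in> vertices (convex hull (V ` S))"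
      by (simp add: vertices_def face_of_singleton)
  qed
qed

text \<open>The normal vector is \<open>x - z\<close>, with \<open>z\<close> the point of the affine
  hull closest to \<open>x\<close>. For empty \<open>A\<close> there is no such point, and the
  constant functional 1 serves.\<close>

lemma affine_functional_separating_point:
  fixes x :: "'a::euclidean_space"
  assumes "x \<notin> affine hull A"
  obtains a b where "\<And>y. y \<in> A \<Longrightarrow> a \<bullet> y + b = 0" "a \<bullet> x + b \<noteq> 0"
proof (cases "A = {}")
  case True
  then show ?thesis using that[of 0 1] by simp
next
  case False
  let ?H = "affine hull A"
  define z where "z = closest_point ?H x"
  have zH: "z \<in> ?H"
    unfolding z_def using False by (intro closest_point_in_set) auto
  have orth: "(x - z) \<bullet> (y - z) = 0" if "y \<in> ?H" for y
  proof -
    have le: "(x - z) \<bullet> (w - z) \<le> 0" if "w \<in> ?H" for w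
      unfolding z_def using that
      by (intro closest_point_dot) (auto simp: affine_imp_convex)
    \<comment> \<open>The reflection of \<open>y\<close> in \<open>z\<close> stays in the affine
      hull; the closest-point inequality at both points forces equality.\<close>
    have "2 *\<^sub>R z + (-1) *\<^sub>R y \<in> ?H"
      using zH \<open>y \<in> ?H\<close> by (intro mem_affine affine_affine_hull) auto
    from le[OF this] le[OF \<open>y \<in> ?H\<close>] show ?thesis
      by (simp add: algebra_simps inner_diff_right inner_add_right scaleR_2)
  qed
  show ?thesis
  proof (rule that[of "x - z" "- ((x - z) \<bullet> z)"])
    show "(x - z) \<bullet> y + - ((x - z) \<bullet> z) = 0" if "y \<in> A" for y
      using orth[of y] that by (simp add: hull_inc inner_diff_right)
    have "x \<noteq> z" using zH assms by auto
    then show "(x - z) \<bullet> x + - ((x - z) \<bullet> z) \<noteq> 0"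
      by (simp flip: inner_diff_right)
  qed
qed

lemma general_linear_position_not_in_affine_hull:
  fixes A :: "'a::euclidean_space set"
  assumes A: "general_linear_position A" and "finite A" "T \<subseteq> A" "card T \<le> DIM('a)"
    and x: "x \<in> A - T"
  shows "x \<notin> affine hull T"
proof
  assume "x \<in> affine hull T"
  then have "affine_dependent (insert x T)"
    using x by (auto simp: affine_dependent_def)
  have "finite T" using \<open>finite A\<close> \<open>T \<subseteq> A\<close> by (rule rev_finite_subset)
  have "card (insert x T) \<le> DIM('a) + 1"
    using x \<open>finite T\<close> \<open>card T \<le> DIM('a)\<close> by simp
  moreover have "DIM('a) + 1 \<le> card A"
    using A \<open>finite A\<close> by (simp add: general_linear_position_def)
  \<comment> \<open>General linear position speaks only of sets of exactly
    \<open>DIM('a) + 1\<close> points, so the dependent set is padded to that size within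
    \<open>A\<close>, which is large enough.\<close>
  ultimately obtain U where "insert x T \<subseteq> U" "U \<subseteq> A" "card U = DIM('a) + 1"
    using exists_subset_between[of "insert x T" "DIM('a) + 1" A] x \<open>finite A\<close> \<open>T \<subseteq> A\<close> by auto
  moreover from this have "affine_dependent U"
    using \<open>affine_dependent (insert x T)\<close> affine_dependent_subset by blast
  ultimately show False
    using A by (auto simp: general_linear_position_def)
qed

lemma veronese_general_position_face:
  fixes W :: "real ^ 'd::finite \<Rightarrow> real ^ 'k::finite"
  assumes V: "veronese_map (2 * r) V" and W: "veronese_map r W" and "1 \<le> r" "finite S"
    and glp: "general_linear_position (W ` S)" and "T \<subseteq> S" "card T \<le> CARD('k)"
  shows "(convex hull (V ` T)) face_of (convex hull (V ` S))"
proof -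
  have inj: "inj W" by (rule inj_veronese_map[OF W \<open>1 \<le> r\<close>])
  have "\<exists>h. polyfun r h \<and> (\<forall>y\<in>T. h y = 0) \<and> h x \<noteq> 0" if "x \<in> S - T" for x
  proof -
    have "W x \<notin> affine hull (W ` T)"
      using that inj \<open>finite S\<close> \<open>T \<subseteq> S\<close> \<open>card T \<le> CARD('k)\<close>
      by (intro general_linear_position_not_in_affine_hull[OF glp])
        (auto simp: inj_def card_image[OF inj_on_subset[OF inj]])
    then obtain a b where "\<And>y. y \<in> W ` T \<Longrightarrow> a \<bullet> y + b = 0" "a \<bullet> W x + b \<noteq> 0"
      using affine_functional_separating_point by blast
    then show ?thesis
      using polyfun_veronese_affine[OF W, of a b] by blast
  qed
  then obtain h where h: "\<And>x. x \<in> S - T \<Longrightarrow> polyfun r (h x)"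
      "\<And>x y. x \<in> S - T \<Longrightarrow> y \<in> T \<Longrightarrow> h x y = 0"
      "\<And>x. x \<in> S - T \<Longrightarrow> h x x \<noteq> 0"
    by metis
  define f where "f y = (\<Sum>x\<in>S - T. h x y * h x y)" for y
  show ?thesis
  proof (rule veronese_face[OF V \<open>finite S\<close> \<open>T \<subseteq> S\<close>])
    show "polyfun (2 * r) f"
      unfolding f_def mult_2 using h(1) by (intro polyfun_sum polyfun_mult)
    show "f y = 0" if "y \<in> T" for y
      unfolding f_def using h(2) that by (intro sum.neutral) auto
    \<comment> \<open>No summand is negative, and the one indexed by \<open>x\<close> itself is
      positive at \<open>x\<close>.\<close>
    show "f x > 0" if "x \<in> S - T" for x
      unfolding f_def using h(3) that \<open>finite S\<close>
      by (intro sum_pos2[of _ x]) (auto simp: zero_less_mult_iff linorder_neq_iff)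
  qed
qed

theorem theorem3p10:
  fixes S :: "(real ^ 'd::finite) set"
    and m :: nat
    and V :: "real ^ 'd \<Rightarrow> real ^ 'n::finite"
  assumes "finite S" and "m \<ge> 2" and "veronese_map m V"
  shows "\<exists>(P :: (real ^ 'n) set) (l :: int).
           polytope_of_dim l P \<and> vertices P = V ` S \<and>
           l \<le> int ((m + CARD('d)) choose m) - 1 \<and>
           (\<forall>W :: real ^ 'd \<Rightarrow> real ^ 'k::finite.
              even m \<and> veronese_map (m div 2) W \<and> general_linear_position (W ` S) \<longrightarrow>
              neighborly (((m div 2 + CARD('d)) choose (m div 2)) - 1) P)"
proof (intro exI conjI allI impI)
  let ?P = "convex hull (V ` S)"
  have polytope: "polytope ?P"
    using \<open>finite S\<close> by (auto simp: polytope_def)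
  then show "polytope_of_dim (aff_dim ?P) ?P"
    by (simp add: polytope_of_dim_def)
  show vert: "vertices ?P = V ` S"
    using assms by (intro vertices_convex_hull_veronese)
  have "aff_dim ?P \<le> int CARD('n)"
    using aff_dim_le_DIM[of ?P] by simp
  \<comment> \<open>Ensures that the truncated subtraction in \<open>CARD('n)\<close> agrees with
    the integer one.\<close>
  moreover have "(m + CARD('d)) choose m \<ge> 1"
    by (simp add: Suc_le_eq)
  ultimately show "aff_dim ?P \<le> int ((m + CARD('d)) choose m) - 1"
    using veronese_map_CARD[OF assms(3)] by (simp add: of_nat_diff)
  fix W :: "real ^ 'd \<Rightarrow> real ^ 'k"
  assume W: "even m \<and> veronese_map (m div 2) W \<and> general_linear_position (W ` S)"
  show "neighborly (((m div 2 + CARD('d)) choose (m div 2)) - 1) ?P"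
    unfolding neighborly_def
  proof (intro conjI allI impI polytope)
    fix T assume T: "T \<subseteq> vertices ?P \<and> finite T \<and>
      card T \<le> ((m div 2 + CARD('d)) choose (m div 2)) - 1"
    then obtain U where U: "U \<subseteq> S" "T = V ` U"
      unfolding vert by (meson subset_image_iff)
    \<comment> \<open>Injectivity carries the bound on the number of vertices over to their
      preimages in \<open>S\<close>.\<close>
    have "inj V"
      using inj_veronese_map[OF assms(3)] \<open>m \<ge> 2\<close> by simp
    then have "card U = card T"
      unfolding U by (metis card_image inj_on_subset subset_UNIV)
    moreover have "card T \<le> CARD('k)"
      using T W veronese_map_CARD by metis
    ultimately show "(convex hull T) face_of ?P"
      unfolding U using assms W U(1)
      \<comment> \<open>Evenness gives \<open>2 * (m div 2) = m\<close>, and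
        \<open>m \<ge> 2\<close> gives \<open>1 \<le> m div 2\<close>.\<close>
      by (intro veronese_general_position_face[of "m div 2" V W]) auto
  qed
qed

end
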